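(* Let $n\ge 1$ and let $F_n$ be the friendship graph with center $c$ and $3$-cycles $T_i=(c,a_i,b_i)$ for $i=1,\dots,n$. A set $S\subseteq V(F_n)$ is a mutual-visibility set of $F_n$ if and only if $S$ satisfies one of the following conditions: (1) $c\notin S$; (2) $c\in S$ and $S\setminus\{c\}\subseteq\{a_i,b_i\}$ for some $i\in\{1,\dots,n\}$.
   Context: Graphs are finite, simple, undirected and connected. For $X\subseteq V(G)$, two vertices $u,v\in V(G)$ are $X$-visible if there is a shortest $(u,v)$-path $P$ in $G$ with $V(P)\cap X\subseteq\{u,v\}$. A set $X\subseteq V(G)$ is a mutual-visibility set of $G$ if every pair of vertices of $X$ is $X$-visible (in particular the empty set and singletons are mutual-visibility sets). The friendship graph $F_n$ is formed by $n$ $3$-cycles having exactly one vertex in common, called the center $c$; it has $2n+1$ vertices $c,a_1,b_1,\dots,a_n,b_n$ and edges $ca_i$, $cb_i$, $a_ib_i$ for $1\le i\le n$. *)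

theory Defs
  imports "Graph_Theory.Digraph_Component"
begin

text \<open>
  An undirected graph is a symmetric digraph, and a path is a list of arcs, so that the
  length of a path is the length of the list. The pairs in the definition of a
  mutual-visibility set include the degenerate ones \<open>u = v\<close>; these impose nothing, see
  \<open>X_visible_refl\<close>.
\<close>

definition shortest_path :: "('a, 'b) pre_digraph \<Rightarrow> 'a \<Rightarrow> 'b awalk \<Rightarrow> 'a \<Rightarrow> bool" where
  "shortest_path G u p v \<longleftrightarrow>
     pre_digraph.apath G u p v \<and> (\<forall>q. pre_digraph.apath G u q v \<longrightarrow> length p \<le> length q)"

definition X_visible :: "('a, 'b) pre_digraph \<Rightarrow> 'a set \<Rightarrow> 'a \<Rightarrow> 'a \<Rightarrow> bool" where
  "X_visible G X u v \<longleftrightarrow>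
     (\<exists>p. shortest_path G u p v \<and> set (pre_digraph.awalk_verts G u p) \<inter> X \<subseteq> {u, v})"

definition mutual_visibility_set :: "('a, 'b) pre_digraph \<Rightarrow> 'a set \<Rightarrow> bool" where
  "mutual_visibility_set G X \<longleftrightarrow> X \<subseteq> verts G \<and> (\<forall>u\<in>X. \<forall>v\<in>X. X_visible G X u v)"

lemma X_visible_refl: "u \<in> verts G \<Longrightarrow> X_visible G X u u"
  unfolding X_visible_def shortest_path_def
  by (rule exI[of _ "[]"])
     (auto simp: pre_digraph.apath_def pre_digraph.awalk_def pre_digraph.cas.simps
        pre_digraph.awalk_verts.simps)

lemma mutual_visibility_set_empty: "mutual_visibility_set G {}"
  by (simp add: mutual_visibility_set_def)

lemma mutual_visibility_set_singleton: "u \<in> verts G \<Longrightarrow> mutual_visibility_set G {u}"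
  by (simp add: mutual_visibility_set_def X_visible_refl)

text \<open>
  \<open>friendship_graph G n c a b\<close>: the graph \<open>G\<close>, on an arbitrary vertex type, is the friendship
  graph made of the triangles \<open>c, a i, b i\<close> for \<open>1 \<le> i \<le> n\<close>; the values of \<open>a\<close> and \<open>b\<close> outside
  \<open>{1..n}\<close> are irrelevant. Each edge is represented by both of its arcs.
\<close>

definition friendship_graph ::
    "'a pair_pre_digraph \<Rightarrow> nat \<Rightarrow> 'a \<Rightarrow> (nat \<Rightarrow> 'a) \<Rightarrow> (nat \<Rightarrow> 'a) \<Rightarrow> bool" where
  "friendship_graph G n c a b \<longleftrightarrow>
     inj_on a {1..n} \<and> inj_on b {1..n} \<and> a ` {1..n} \<inter> b ` {1..n} = {} \<and>
     c \<notin> a ` {1..n} \<union> b ` {1..n} \<and>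
     pverts G = {c} \<union> a ` {1..n} \<union> b ` {1..n} \<and>
     parcs G = (\<Union>i\<in>{1..n}. {(c, a i), (a i, c), (c, b i), (b i, c), (a i, b i), (b i, a i)})"

lemma friendship_graph_exists:
  "\<exists>(G :: nat pair_pre_digraph) c a b. friendship_graph G n c a b"
proof -
  let ?a = "\<lambda>i::nat. 2 * i" and ?b = "\<lambda>i::nat. Suc (2 * i)"
  let ?G = "\<lparr> pverts = {0} \<union> ?a ` {1..n} \<union> ?b ` {1..n},
     parcs = (\<Union>i\<in>{1..n}. {(0, ?a i), (?a i, 0), (0, ?b i), (?b i, 0), (?a i, ?b i), (?b i, ?a i)}) \<rparr>"
  have "?a i \<noteq> ?b j" for i j by presburger
  then have "friendship_graph ?G n 0 ?a ?b"
    unfolding friendship_graph_def by (auto simp: inj_on_def)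
  then show ?thesis by blast
qed

lemma friendship_graph_card:
  assumes "friendship_graph G n c a b"
  shows "card (pverts G) = 2 * n + 1"
proof -
  have "card (a ` {1..n} \<union> b ` {1..n}) = n + n"
    using assms unfolding friendship_graph_def by (subst card_Un_disjoint) (auto simp: card_image)
  then show ?thesis
    using assms unfolding friendship_graph_def by simp
qed

lemma friendship_graph_pair_graph:
  assumes "friendship_graph G n c a b"
  shows "pair_graph G"
proof
  fix e
  assume e: "e \<in> parcs G"
  from e show "fst e \<in> pverts G" "snd e \<in> pverts G"
    using assms unfolding friendship_graph_def by auto
  have "a i \<noteq> b i" "a i \<noteq> c" "b i \<noteq> c" if "i \<in> {1..n}" for i
    using that assms unfolding friendship_graph_def by blast+
  with e show "fst e \<noteq> snd e"
    using assms unfolding friendship_graph_def by fastforce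
next
  show "finite (pverts G)" "finite (parcs G)"
    using assms unfolding friendship_graph_def by simp_all
next
  have "(v, u) \<in> parcs G" if "(u, v) \<in> parcs G" for u v
    using that assms unfolding friendship_graph_def by auto
  then show "symmetric G"
    unfolding symmetric_def sym_def with_proj_simps by blast
qed

lemma friendship_graph_connected:
  assumes "friendship_graph G n c a b"
  shows "connected G"
proof -
  interpret pair_graph G by (rule friendship_graph_pair_graph[OF assms])
  have c: "c \<in> pverts G" using assms by (simp add: friendship_graph_def)
  have adj: "v = c \<or> (v, c) \<in> parcs G \<and> (c, v) \<in> parcs G" if "v \<in> pverts G" for v
    using that assms unfolding friendship_graph_def by auto
  have "v \<rightarrow>\<^sup>*\<^bsub>G\<^esub> c" "c \<rightarrow>\<^sup>*\<^bsub>G\<^esub> v" if "v \<in> pverts G" for v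
    using adj[OF that] c by auto
  then have "strongly_connected G"
    unfolding strongly_connected_def using c by (auto intro: reachable_trans)
  moreover have "mk_symmetric (with_proj G) = G"
    using sym_arcs unfolding symmetric_def sym_def
    by (intro pair_pre_digraph.equality) (auto simp: mk_symmetric_def)
  ultimately show ?thesis by (simp add: connected_def)
qed

end

theory Submission
  imports Defs
begin

text \<open>
  Two distinct non-adjacent vertices have the center as their only common neighbour, so they
  see each other exactly when the center is not in \<open>S\<close>. A set containing the center is
  therefore a mutual-visibility set if and only if it is a clique.
\<close>

context pair_graph
begin

lemma loop_notin_parcs: "(v, v) \<notin> parcs G"
  using no_loops by fastforce

lemma apath_arcI:
  assumes "(u, v) \<in> parcs G"
  shows "apath u [(u, v)] v"
  using assms loop_notin_parcs by (auto simp: apath_def awalk_def intro: in_arcsD1 in_arcsD2)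

text \<open>An \<open>apath\<close> has distinct vertices: \<open>u \<noteq> v\<close> separates the
  ends, and the absence of loops separates \<open>w\<close> from both.\<close>

lemma apath_two_arcsI:
  assumes "(u, w) \<in> parcs G" "(w, v) \<in> parcs G" "u \<noteq> v"
  shows "apath u [(u, w), (w, v)] v"
  using assms loop_notin_parcs by (auto simp: apath_def awalk_def intro: in_arcsD1 in_arcsD2)

lemma awalk_length_one:
  assumes "awalk u p v" "length p = 1"
  shows "(u, v) \<in> parcs G"
  using assms by (cases p) (auto simp: awalk_def)

lemma awalk_length_two:
  assumes "awalk u p v" "length p = 2"
  obtains w where "p = [(u, w), (w, v)]" "(u, w) \<in> parcs G" "(w, v) \<in> parcs G"
proof -
  from assms(2) obtain d e where "p = [d, e]"
    by (auto simp: length_Suc_conv numeral_2_eq_2)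
  with assms(1) show thesis
    \<comment> \<open>The middle vertex is the head of the first arc.\<close>
    by (intro that[of "snd d"]; cases d; cases e) (auto simp: awalk_def)
qed

lemma apath_nonempty:
  assumes "apath u p v" "u \<noteq> v"
  shows "p \<noteq> []"
  using assms by (auto simp: apath_def awalk_def)

text \<open>The single arc is a shortest path, since a path between distinct vertices is nonempty,
  and it has no inner vertex that could lie in \<open>X\<close>.\<close>

lemma X_visible_adjacent:
  assumes "(u, v) \<in> parcs G"
  shows "X_visible G X u v"
proof -
  have "u \<noteq> v" using assms loop_notin_parcs by auto
  then have "shortest_path G u [(u, v)] v"
    using apath_arcI[OF assms] apath_nonempty
    by (auto simp: shortest_path_def Suc_le_eq)
  then show ?thesis by (auto simp: X_visible_def)
qed

text \<open>Distance two with one common neighbour leaves exactly one shortest path, so visibility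
  depends only on its inner vertex \<open>c\<close>.\<close>

lemma X_visible_unique_common_neighbour:
  assumes uv: "u \<noteq> v" "(u, v) \<notin> parcs G"
    and c: "(u, c) \<in> parcs G" "(c, v) \<in> parcs G"
    and uniq: "\<And>w. (u, w) \<in> parcs G \<Longrightarrow> (w, v) \<in> parcs G \<Longrightarrow> w = c"
  shows "X_visible G X u v \<longleftrightarrow> c \<notin> X"
proof -
  have two: "apath u [(u, c), (c, v)] v"
    using c uv(1) by (rule apath_two_arcsI)
  have long: "2 \<le> length p" if "apath u p v" for p
  proof -
    have "length p \<noteq> 0" using apath_nonempty[OF that uv(1)] by simp
    moreover have "length p \<noteq> 1"
      using awalk_length_one that uv(2) by (auto simp: apath_def)
    ultimately show ?thesis by linarith
  qed
  \<comment> \<open>The path through \<open>c\<close> bounds the length by 2 and \<open>long\<close>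
    gives the converse bound, so the middle vertex of \<open>p\<close> is a common neighbour of
    \<open>u\<close> and \<open>v\<close>.\<close>
  have "p = [(u, c), (c, v)]" if p: "shortest_path G u p v" for p
  proof -
    have "apath u p v" "length p \<le> 2"
      using p two by (force simp: shortest_path_def)+
    with long[of p] have "awalk u p v" "length p = 2" by (auto simp: apath_def)
    then show ?thesis using uniq by (metis awalk_length_two)
  qed
  moreover have "shortest_path G u [(u, c), (c, v)] v"
    using two long by (auto simp: shortest_path_def numeral_2_eq_2)
  ultimately have "shortest_path G u p v \<longleftrightarrow> p = [(u, c), (c, v)]" for p
    by blast
  then have "X_visible G X u v \<longleftrightarrow> {u, c, v} \<inter> X \<subseteq> {u, v}"
    by (simp add: X_visible_def)
  \<comment> \<open>Hence \<open>c\<close> is a proper inner vertex, and the inclusion fails exactly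
    when \<open>c\<close> is in \<open>X\<close>.\<close>
  moreover have "c \<noteq> u" "c \<noteq> v" using c loop_notin_parcs by auto
  ultimately show ?thesis by auto
qed

end

context
  fixes G :: "'a pair_pre_digraph" and n c a b
  assumes F: "friendship_graph G n c a b"
begin

lemma friendship_graph_center_adjacent:
  assumes "v \<in> pverts G" "v \<noteq> c"
  shows "(v, c) \<in> parcs G" "(c, v) \<in> parcs G"
  using assms F by (auto simp: friendship_graph_def)

text \<open>Deleting the center leaves the disjoint edges \<open>a i\<close>, \<open>b i\<close>, so
  "equal or adjacent" describes the triangle of \<open>u\<close>. The center must be excluded as
  \<open>v\<close>: it is adjacent to \<open>u\<close> but lies outside the pair.\<close>

lemma friendship_graph_same_triangle_iff:
  assumes "i \<in> {1..n}" "u \<in> {a i, b i}" "v \<noteq> c"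
  shows "v \<in> {a i, b i} \<longleftrightarrow> u = v \<or> (u, v) \<in> parcs G"
proof -
  have F': "inj_on a {1..n}" "inj_on b {1..n}" "a ` {1..n} \<inter> b ` {1..n} = {}"
    "c \<notin> a ` {1..n} \<union> b ` {1..n}"
    using F by (simp_all add: friendship_graph_def)
  have inj: "a i = a j \<longleftrightarrow> i = j" "b i = b j \<longleftrightarrow> i = j" if "j \<in> {1..n}" for j
    using F'(1,2) assms(1) that by (simp_all only: inj_on_eq_iff)
  have disj: "a i \<noteq> b j" "b i \<noteq> a j" if "j \<in> {1..n}" for j
    using F'(3) assms(1) that by blast+
  have "a i \<noteq> c" "b i \<noteq> c"
    using F'(4) assms(1) by blast+
  with assms(2) have "u \<noteq> c" by auto
  moreover have "parcs G =
      (\<Union>j\<in>{1..n}. {(c, a j), (a j, c), (c, b j), (b j, c), (a j, b j), (b j, a j)})"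
    using F by (simp add: friendship_graph_def)
  \<comment> \<open>As neither \<open>u\<close> nor \<open>v\<close> is the center, only the arcs
    between some \<open>a j\<close> and \<open>b j\<close> remain.\<close>
  ultimately have arc: "(u, v) \<in> parcs G \<longleftrightarrow>
      (\<exists>j\<in>{1..n}. u = a j \<and> v = b j) \<or> (\<exists>j\<in>{1..n}. u = b j \<and> v = a j)"
    using assms(3) by blast
  from assms(2) consider "u = a i" | "u = b i" by blast
  then show ?thesis
  proof cases
    case 1
    with inj disj have "(u, v) \<in> parcs G \<longleftrightarrow> v = b i"
      unfolding arc using assms(1) by auto
    with 1 show ?thesis by blast
  next
    case 2
    with inj disj have "(u, v) \<in> parcs G \<longleftrightarrow> v = a i"
      unfolding arc using assms(1) by auto
    with 2 show ?thesis by blast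
  qed
qed

lemma friendship_graph_vertex_cases:
  assumes "v \<in> pverts G" "v \<noteq> c"
  obtains i where "i \<in> {1..n}" "v \<in> {a i, b i}"
  using assms F by (auto simp: friendship_graph_def)

lemma friendship_graph_X_visible_iff:
  assumes u: "u \<in> pverts G" and v: "v \<in> pverts G"
  shows "X_visible G X u v \<longleftrightarrow> u = v \<or> (u, v) \<in> parcs G \<or> c \<notin> X"
proof -
  interpret pair_graph G by (rule friendship_graph_pair_graph[OF F])
  consider "u = v" | "(u, v) \<in> parcs G" | "u \<noteq> v" "(u, v) \<notin> parcs G" by blast
  then show ?thesis
  proof cases
    case 1
    then show ?thesis using u by (simp add: X_visible_refl)
  next
    case 2
    then show ?thesis by (simp add: X_visible_adjacent)
  next
    case 3
    \<comment> \<open>The center is adjacent to every other vertex, so it cannot belong to a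
      distinct non-adjacent pair.\<close>
    then have c: "u \<noteq> c" "v \<noteq> c"
      using friendship_graph_center_adjacent u v by auto
    obtain i where i: "i \<in> {1..n}" "u \<in> {a i, b i}"
      using friendship_graph_vertex_cases u c(1) by blast
    \<comment> \<open>A common neighbour other than \<open>c\<close> would lie in the triangle of
      \<open>u\<close> and pull \<open>v\<close> into it, making \<open>u\<close> and
      \<open>v\<close> equal or adjacent.\<close>
    have "w = c" if w: "(u, w) \<in> parcs G" "(w, v) \<in> parcs G" for w
    proof (rule ccontr)
      assume "w \<noteq> c"
      then have "w \<in> {a i, b i}"
        using friendship_graph_same_triangle_iff i w(1) by blast
      then have "v \<in> {a i, b i}"
        using friendship_graph_same_triangle_iff i(1) w(2) c(2) by blast
      then show False
        using friendship_graph_same_triangle_iff i c(2) 3 by blast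
    qed
    then show ?thesis
      using X_visible_unique_common_neighbour[of u v c X]
        friendship_graph_center_adjacent u v c 3 by blast
  qed
qed

end

theorem lemma10:
  fixes G :: "'a pair_pre_digraph" and n :: nat and c :: 'a and a b :: "nat \<Rightarrow> 'a" and S :: "'a set"
  assumes "n \<ge> 1"
    and "friendship_graph G n c a b"
    and "S \<subseteq> pverts G"
  shows "mutual_visibility_set (with_proj G) S \<longleftrightarrow>
    c \<notin> S \<or> (c \<in> S \<and> (\<exists>i\<in>{1..n}. S - {c} \<subseteq> {a i, b i}))"
proof -
  note F = assms(2)
  have mv: "mutual_visibility_set G S \<longleftrightarrow>
      c \<notin> S \<or> (\<forall>u\<in>S. \<forall>v\<in>S. u = v \<or> (u, v) \<in> parcs G)"
    using friendship_graph_X_visible_iff[OF F] assms(3)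
    by (auto simp: mutual_visibility_set_def subset_iff)
  have "(\<forall>u\<in>S. \<forall>v\<in>S. u = v \<or> (u, v) \<in> parcs G) \<longleftrightarrow> (\<exists>i\<in>{1..n}. S - {c} \<subseteq> {a i, b i})"
    (is "?clique \<longleftrightarrow> ?triangle")
  proof
    assume clique: ?clique
    show ?triangle
    proof (cases "S \<subseteq> {c}")
      case True
      \<comment> \<open>Here \<open>S - {c}\<close> is empty and any triangle serves; the index 1 is
        available because \<open>n \<ge> 1\<close>.\<close>
      then show ?thesis using assms(1) by (intro bexI[of _ 1]) auto
    next
      case False
      then obtain u where u: "u \<in> S" "u \<noteq> c" by blast
      then obtain i where "i \<in> {1..n}" "u \<in> {a i, b i}"
        using friendship_graph_vertex_cases[OF F] assms(3) by blast
      \<comment> \<open>The vertex \<open>u\<close> fixes the triangle: every non-central member of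
        the clique is equal or adjacent to \<open>u\<close>.\<close>
      then show ?thesis
        using clique u(1) friendship_graph_same_triangle_iff[OF F] by blast
    qed
  next
    assume ?triangle
    then obtain i where i: "i \<in> {1..n}" "S - {c} \<subseteq> {a i, b i}" by blast
    show ?clique
    proof (intro ballI)
      fix u v
      assume uv: "u \<in> S" "v \<in> S"
      show "u = v \<or> (u, v) \<in> parcs G"
      proof (cases "u = c \<or> v = c")
        case True
        then show ?thesis
          using friendship_graph_center_adjacent[OF F] uv assms(3) by blast
      next
        case False
        then show ?thesis
          using friendship_graph_same_triangle_iff[OF F i(1)] i(2) uv by blast
      qed
    qed
  qed
  with mv show ?thesis by blast
qed

end
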